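(* Let $n\ge 1$, $m\in\{1,2,\dots\}$, $a\in\mathbb{R}^n$, and let $W\in\mathbb{R}^{n\times n}$ be a symmetric matrix with $\|W\|<1$. Let $q(x)=Wx+a$, and let $x_*$ be the unique fixed point of $q$. Define $$w_0=\sup_{\delta\ge 0}\ \sin\Bigg[\sin^{-1}\Big(\frac{|\lambda_{\max}(W)-\lambda_{\min}(W)|\,\delta}{\sqrt{4+(2-\lambda_{\max}(W)-\lambda_{\min}(W))^2\delta^2}}\Big)+\Big|\tan^{-1}(\delta)-\tan^{-1}\Big(\big(1-\tfrac{\lambda_{\max}(W)+\lambda_{\min}(W)}{2}\big)\delta\Big)\Big|\Bigg].$$ Then for every initialization $x^{(0)}\in\mathbb{R}^n$, the sequence $\{x^{(k)}\}$ generated by AA(m) applied to $q$ converges $r$-linearly to $x_*$ with $r$-linear convergence factor at most $\sqrt{w_0\|W\|}$. More specifically, for all $k\ge 2$ (with $x^{(k-1)}\neq x_*$), $$\frac{\|(W-I)(x^{(k+1)}-x_* )\|}{\|(W-I)(x^{(k-1)}-x_* )\|}\le w_0\|W\|.$$ Moreover $w_0\le\|W\|$, with equality if and only if $\lambda_{\max}(W)=-\lambda_{\min}(W)$.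
   Context: $\|\cdot\|$ is the Euclidean norm on vectors and the spectral (operator) norm on matrices; $\lambda_{\max}(W),\lambda_{\min}(W)$ are the largest and smallest eigenvalues of $W$; $I$ is the identity matrix. Windowed Anderson acceleration of depth $m$, AA(m), applied to $q:\mathbb{R}^n\to\mathbb{R}^n$ from $x^{(0)}\in\mathbb{R}^n$: set $x^{(1)}=q(x^{(0)})$. For $k=1,2,\dots$, let $m_k=\min(m,k)$, let $(\alpha^{(k)}_j)_{j=k-m_k}^{k}$ be real numbers minimizing $\big\|\sum_{j=k-m_k}^{k}\alpha_j\,(q(x^{(j)})-x^{(j)})\big\|$ subject to $\sum_{j=k-m_k}^{k}\alpha_j=1$, and set $x^{(k+1)}=\sum_{j=k-m_k}^{k}\alpha^{(k)}_j\,q(x^{(j)})$. For a sequence $\{x^{(k)}\}$ converging to $x_*$, its $r$-linear convergence factor is $\limsup_{k\to\infty}\|x_*-x^{(k)}\|^{1/k}$. *)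

theory Defs
  imports "HOL-Analysis.Analysis"
begin

definition spectral_norm :: "real ^ 'n ^ 'n \<Rightarrow> real"
  where "spectral_norm W = onorm ((*v) W)"

definition eigenvalues :: "real ^ 'n ^ 'n \<Rightarrow> real set"
  where "eigenvalues W = {c. \<exists>v. v \<noteq> 0 \<and> W *v v = c *\<^sub>R v}"

text \<open>Only meaningful when the set of real eigenvalues is finite and nonempty,
  as it is for symmetric matrices.\<close>

definition lambda_max :: "real ^ 'n ^ 'n \<Rightarrow> real"
  where "lambda_max W = Max (eigenvalues W)"

definition lambda_min :: "real ^ 'n ^ 'n \<Rightarrow> real"
  where "lambda_min W = Min (eigenvalues W)"

definition anderson_weights ::
    "nat \<Rightarrow> (real ^ 'n \<Rightarrow> real ^ 'n) \<Rightarrow> (nat \<Rightarrow> real ^ 'n) \<Rightarrow> nat \<Rightarrow> (nat \<Rightarrow> real) \<Rightarrow> bool"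
  where "anderson_weights m q x k \<alpha> \<longleftrightarrow>
    (let J = {k - min m k..k} in
      (\<Sum>j\<in>J. \<alpha> j) = 1 \<and>
      (\<forall>\<beta>. (\<Sum>j\<in>J. \<beta> j) = 1 \<longrightarrow>
         norm (\<Sum>j\<in>J. \<alpha> j *\<^sub>R (q (x j) - x j)) \<le> norm (\<Sum>j\<in>J. \<beta> j *\<^sub>R (q (x j) - x j))))"

text \<open>A relation rather than a function: the minimizing weights need not be unique, and any
  choice of them is admitted at every step.\<close>

definition anderson_sequence ::
    "nat \<Rightarrow> (real ^ 'n \<Rightarrow> real ^ 'n) \<Rightarrow> real ^ 'n \<Rightarrow> (nat \<Rightarrow> real ^ 'n) \<Rightarrow> bool"
  where "anderson_sequence m q x0 x \<longleftrightarrow>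
    x 0 = x0 \<and> x 1 = q x0 \<and>
    (\<forall>k\<ge>1. \<exists>\<alpha>. anderson_weights m q x k \<alpha> \<and>
       x (k + 1) = (\<Sum>j\<in>{k - min m k..k}. \<alpha> j *\<^sub>R q (x j)))"

definition r_factor :: "(nat \<Rightarrow> real ^ 'n) \<Rightarrow> real ^ 'n \<Rightarrow> ereal"
  where "r_factor x l = limsup (\<lambda>k. ereal (norm (l - x k) powr (1 / real k)))"

definition converges_r_linearly :: "(nat \<Rightarrow> real ^ 'n) \<Rightarrow> real ^ 'n \<Rightarrow> bool"
  where "converges_r_linearly x l \<longleftrightarrow> x \<longlonglongrightarrow> l \<and> r_factor x l < 1"

definition w0 :: "real ^ 'n ^ 'n \<Rightarrow> real"
  where "w0 W = (SUP \<delta>\<in>{0..}.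
    sin (arcsin (\<bar>lambda_max W - lambda_min W\<bar> * \<delta> /
                 sqrt (4 + (2 - lambda_max W - lambda_min W)\<^sup>2 * \<delta>\<^sup>2))
         + \<bar>arctan \<delta> - arctan ((1 - (lambda_max W + lambda_min W) / 2) * \<delta>)\<bar>))"

end

theory Submission
  imports Defs "HOL-Real_Asymp.Real_Asymp"
begin

text \<open>The residual \<open>r k = q (x k) - x k = (W - I) (x k - xs)\<close> satisfies \<open>r (k + 1) = W p\<close>, where
  \<open>p\<close> is the point of minimal norm in the affine hull of the residuals in the window. Hence
  \<open>r k = p + s\<close> with \<open>s\<close> orthogonal to \<open>p\<close>, and the minimizer of the next step is at most as
  long as the distance from 0 to the line through \<open>p + s\<close> and \<open>W p\<close>. Since \<open>W p\<close> lies in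
  the ball around \<open>c p\<close> of radius \<open>\<rho> |p|\<close>, where \<open>c\<close> and \<open>\<rho>\<close> are the midpoint and half-length
  of the spectral interval, the triangle inequality for angles bounds this distance by
  \<open>w0 |p + s|\<close>; the parameter is \<open>\<delta> = |p| / |s|\<close>, and \<open>s = 0\<close> is the limit \<open>\<delta> \<rightarrow> \<infinity>\<close>. One more
  application of \<open>W\<close> gives \<open>|r (k + 2)| \<le> w0 |W| |r k|\<close>.

  For \<open>w0 \<le> |W| = |c| + \<rho>\<close>: the same line passes through a point of norm at most
  \<open>(|c| + \<rho>) |p|\<close>, which yields the bound \<open>(|c| + \<rho>) \<delta> / sqrt (1 + \<delta>\<^sup>2)\<close>. For \<open>c \<noteq> 0\<close> it is
  bounded away from \<open>|c| + \<rho>\<close> on bounded sets of \<open>\<delta>\<close>, and at infinity the limit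
  \<open>\<rho> / (1 - c)\<close> is smaller than \<open>|c| + \<rho>\<close>.\<close>

section \<open>Extreme eigenvalues of a symmetric matrix\<close>

text \<open>First-order condition at a minimum: near t = 0 the linear term decides the sign. It
  serves both the Rayleigh maximizer and the point of minimal norm.\<close>

lemma quadratic_nonneg_imp_linear_zero:
  fixes a b :: real
  assumes "\<And>t. 0 \<le> 2 * t * a + t\<^sup>2 * b"
  shows "a = 0"
proof (rule ccontr)
  assume a: "a \<noteq> 0"
  have b: "0 \<le> b"
    using assms[of 1] assms[of "-1"] by simp
  \<comment> \<open>The vertex \<open>- a / b\<close>, with \<open>b + 1\<close> in place of
    \<open>b\<close> to cover \<open>b = 0\<close>.\<close>
  have "0 \<le> 2 * (- a / (b + 1)) * a + (- a / (b + 1))\<^sup>2 * b"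
    by (rule assms)
  also have "\<dots> = - a\<^sup>2 * (b + 2) / (b + 1)\<^sup>2"
    using b by (simp add: divide_simps) (simp add: power2_eq_square algebra_simps)
  also have "\<dots> < 0"
    using a b by (simp add: divide_neg_pos)
  finally show False by simp
qed

lemma inner_symmetric_matrix:
  fixes W :: "real ^ 'n ^ 'n"
  assumes "transpose W = W"
  shows "x \<bullet> (W *v y) = (W *v x) \<bullet> y"
  using dot_lmul_matrix[of x W y] assms by (metis transpose_matrix_vector)

text \<open>Polarization: symmetry writes the form at (x, y) as a difference of quadratic values at
  x + y and x - y, and the parallelogram law adds up their bounds.\<close>

lemma symmetric_norm_le_numerical_radius:
  fixes W :: "real ^ 'n ^ 'n"
  assumes sym: "transpose W = W"
    and bound: "\<And>x. \<bar>x \<bullet> (W *v x)\<bar> \<le> K * (norm x)\<^sup>2"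
  shows "norm (W *v x) \<le> K * norm x"
proof (cases "W *v x = 0 \<or> x = 0")
  case True
  have "0 \<le> K * (norm x)\<^sup>2"
    using bound[of x] by linarith
  then show ?thesis
    using True by (auto simp: zero_le_mult_iff)
next
  case False
  \<comment> \<open>The multiple of \<open>W *v x\<close> as long as \<open>x\<close>: its inner
    product with \<open>W *v x\<close> is the product of the norms.\<close>
  define y where "y = (norm x / norm (W *v x)) *\<^sub>R (W *v x)"
  have ny: "norm y = norm x"
    using False by (simp add: y_def)
  have "4 * (y \<bullet> (W *v x)) = (x + y) \<bullet> (W *v (x + y)) - (x - y) \<bullet> (W *v (x - y))"
    using inner_symmetric_matrix[OF sym, of x y] inner_commute[of "W *v x" y]
    by (simp add: matrix_vector_right_distrib matrix_vector_mult_diff_distrib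
        inner_add_left inner_add_right inner_diff_left inner_diff_right)
  also have "\<dots> \<le> K * (norm (x + y))\<^sup>2 + K * (norm (x - y))\<^sup>2"
    using bound[of "x + y"] bound[of "x - y"] by linarith
  also have "\<dots> = K * (2 * (norm x)\<^sup>2 + 2 * (norm y)\<^sup>2)"
    unfolding distrib_left[symmetric] power2_norm_eq_inner
    by (simp add: inner_add_left inner_add_right inner_diff_left inner_diff_right)
  also have "\<dots> = 4 * (K * (norm x)\<^sup>2)"
    by (simp add: ny)
  finally have "y \<bullet> (W *v x) \<le> K * (norm x)\<^sup>2" by simp
  moreover have "y \<bullet> (W *v x) = norm x * norm (W *v x)"
    using False by (simp add: y_def power2_norm_eq_inner[symmetric] power2_eq_square)
  ultimately show ?thesis
    using False by (simp add: power2_eq_square mult.left_commute)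
qed

text \<open>The quadratic form attains its maximum on the compact unit sphere, and stationarity at
  the maximizer is the eigenvector equation.\<close>

lemma symmetric_max_Rayleigh_eigenvector:
  fixes W :: "real ^ 'n ^ 'n"
  assumes sym: "transpose W = W"
  obtains M v where "v \<noteq> 0" "W *v v = M *\<^sub>R v" "\<And>x. x \<bullet> (W *v x) \<le> M * (norm x)\<^sup>2"
proof -
  have "\<exists>v\<in>sphere 0 1. \<forall>x\<in>sphere 0 1. x \<bullet> (W *v x) \<le> v \<bullet> (W *v v)"
    by (intro continuous_attains_sup continuous_intros linear_continuous_on
        matrix_vector_mul_bounded_linear) simp_all
  then obtain v where v: "norm v = 1"
    and max: "\<And>x. norm x = 1 \<Longrightarrow> x \<bullet> (W *v x) \<le> v \<bullet> (W *v v)"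
    by auto
  define M where "M = v \<bullet> (W *v v)"
  have le: "x \<bullet> (W *v x) \<le> M * (norm x)\<^sup>2" for x
  proof (cases "x = 0")
    case False
    have "norm x *\<^sub>R sgn x = x"
      using False by (simp add: sgn_div_norm)
    then have "x \<bullet> (W *v x) = (norm x *\<^sub>R sgn x) \<bullet> (W *v (norm x *\<^sub>R sgn x))"
      by simp
    also have "\<dots> = (norm x)\<^sup>2 * (sgn x \<bullet> (W *v sgn x))"
      by (simp only: matrix_vector_mult_scaleR inner_scaleR_left inner_scaleR_right
          power2_eq_square mult.assoc)
    also have "\<dots> \<le> (norm x)\<^sup>2 * M"
      using max[of "sgn x"] False by (simp add: M_def norm_sgn)
    finally show ?thesis by (simp add: mult.commute)
  qed simp
  \<comment> \<open>The form \<open>M * (norm z)\<^sup>2 - z \<bullet> (W *v z)\<close> is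
    nonnegative and vanishes at \<open>z = v\<close>, so its derivative at \<open>v\<close> in each
    direction \<open>y\<close> is zero.\<close>
  have "(M *\<^sub>R v - W *v v) \<bullet> y = 0" for y
  proof (rule quadratic_nonneg_imp_linear_zero[where b = "M * (norm y)\<^sup>2 - y \<bullet> (W *v y)"])
    fix t :: real
    have "0 \<le> M * (norm (v + t *\<^sub>R y))\<^sup>2 - (v + t *\<^sub>R y) \<bullet> (W *v (v + t *\<^sub>R y))"
      using le by simp
    also have "\<dots> = 2 * t * ((M *\<^sub>R v - W *v v) \<bullet> y) + t\<^sup>2 * (M * (norm y)\<^sup>2 - y \<bullet> (W *v y))
        + (M * (v \<bullet> v) - v \<bullet> (W *v v))"
    proof -
      have "(norm (v + t *\<^sub>R y))\<^sup>2 = v \<bullet> v + 2 * t * (v \<bullet> y) + t\<^sup>2 * (norm y)\<^sup>2"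
        unfolding power2_norm_eq_inner
        by (simp add: inner_add_left inner_add_right inner_commute[of y v] power2_eq_square
            algebra_simps)
      moreover have "(v + t *\<^sub>R y) \<bullet> (W *v (v + t *\<^sub>R y))
          = v \<bullet> (W *v v) + 2 * t * ((W *v v) \<bullet> y) + t\<^sup>2 * (y \<bullet> (W *v y))"
        using inner_symmetric_matrix[OF sym, of v y]
        by (simp add: matrix_vector_right_distrib matrix_vector_mult_scaleR inner_add_left
            inner_add_right power2_eq_square inner_commute[of y "W *v v"]
            algebra_simps)
      ultimately show ?thesis
        by (simp add: inner_diff_left algebra_simps)
    qed
    also have "M * (v \<bullet> v) - v \<bullet> (W *v v) = 0"
      using v by (simp add: M_def norm_eq_1)
    finally show "0 \<le> 2 * t * ((M *\<^sub>R v - W *v v) \<bullet> y) + t\<^sup>2 * (M * (norm y)\<^sup>2 - y \<bullet> (W *v y))"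
      by simp
  qed
  from this[of "M *\<^sub>R v - W *v v"] have "W *v v = M *\<^sub>R v" by simp
  moreover have "v \<noteq> 0" using v by auto
  ultimately show thesis using le that by blast
qed

text \<open>Eigenvectors for distinct eigenvalues are orthogonal, hence independent, and independent
  sets are finite here. This gives \<open>Max\<close> and \<open>Min\<close> of the spectrum their
  intended meaning.\<close>

lemma finite_eigenvalues_symmetric:
  fixes W :: "real ^ 'n ^ 'n"
  assumes sym: "transpose W = W"
  shows "finite (eigenvalues W)"
proof -
  have "\<forall>c\<in>eigenvalues W. \<exists>v. v \<noteq> 0 \<and> W *v v = c *\<^sub>R v"
    by (auto simp: eigenvalues_def)
  then obtain v where v: "\<And>c. c \<in> eigenvalues W \<Longrightarrow> v c \<noteq> 0 \<and> W *v v c = c *\<^sub>R v c"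
    by metis
  have orth: "v c \<bullet> v d = 0" if "c \<in> eigenvalues W" "d \<in> eigenvalues W" "c \<noteq> d" for c d
    using inner_symmetric_matrix[OF sym, of "v c" "v d"] v[OF that(1)] v[OF that(2)] that(3)
    by simp
  have "inj_on v (eigenvalues W)"
    using orth v by (intro inj_onI) (metis inner_eq_zero_iff)
  moreover have "independent (v ` eigenvalues W)"
    using orth v by (intro pairwise_orthogonal_independent)
      (auto simp: pairwise_def orthogonal_def; metis)+
  then have "finite (v ` eigenvalues W)"
    by (rule independent_imp_finite)
  ultimately show ?thesis by (simp add: finite_image_iff)
qed

lemma lambda_max_symmetric:
  fixes W :: "real ^ 'n ^ 'n"
  assumes sym: "transpose W = W"
  shows "lambda_max W \<in> eigenvalues W" "x \<bullet> (W *v x) \<le> lambda_max W * (norm x)\<^sup>2"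
proof -
  obtain M v where M: "v \<noteq> 0" "W *v v = M *\<^sub>R v" "\<And>x. x \<bullet> (W *v x) \<le> M * (norm x)\<^sup>2"
    using symmetric_max_Rayleigh_eigenvector[OF sym] by blast
  have mem: "M \<in> eigenvalues W"
    using M by (auto simp: eigenvalues_def)
  moreover have "c \<le> M" if "c \<in> eigenvalues W" for c
    using that M(3) by (auto simp: eigenvalues_def power2_norm_eq_inner)
      (metis inner_gt_zero_iff inner_scaleR_right mult_le_cancel_right_pos)
  ultimately have "lambda_max W = M"
    unfolding lambda_max_def using finite_eigenvalues_symmetric[OF sym] by (intro Max_eqI) auto
  then show "lambda_max W \<in> eigenvalues W" "x \<bullet> (W *v x) \<le> lambda_max W * (norm x)\<^sup>2"
    using mem M by auto
qed

lemma uminus_matrix_vector_mult: "(- W) *v x = - (W *v x)" for W :: "real ^ 'n ^ 'm"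
  by (metis matrix_vector_mult_0 add.inverse_unique add_cancel_right_left
      matrix_vector_mult_add_rdistrib neg_eq_iff_add_eq_0)

lemma lambda_min_symmetric:
  fixes W :: "real ^ 'n ^ 'n"
  assumes sym: "transpose W = W"
  shows "lambda_min W \<in> eigenvalues W" "lambda_min W * (norm x)\<^sup>2 \<le> x \<bullet> (W *v x)"
proof -
  \<comment> \<open>The smallest eigenvalue of \<open>W\<close> is minus the largest one of
    \<open>- W\<close>.\<close>
  have sym': "transpose (- W) = - W"
    using sym by (simp add: transpose_def vec_eq_iff)
  obtain M v where M: "v \<noteq> 0" "(- W) *v v = M *\<^sub>R v" "\<And>x. x \<bullet> ((- W) *v x) \<le> M * (norm x)\<^sup>2"
    using symmetric_max_Rayleigh_eigenvector[OF sym'] by blast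
  then have "W *v v = (- M) *\<^sub>R v"
    by (simp add: uminus_matrix_vector_mult) (metis add.inverse_inverse)
  with M have mem: "- M \<in> eigenvalues W"
    by (auto simp: eigenvalues_def)
  have ge: "- M * (norm x)\<^sup>2 \<le> x \<bullet> (W *v x)" for x
    using M(3)[of x] by (simp add: uminus_matrix_vector_mult)
  have "- M \<le> c" if c: "c \<in> eigenvalues W" for c
  proof -
    obtain u where u: "u \<noteq> 0" "W *v u = c *\<^sub>R u"
      using c by (auto simp: eigenvalues_def)
    show ?thesis using ge[of u] u
      by (metis inner_gt_zero_iff inner_scaleR_right mult_le_cancel_right_pos power2_norm_eq_inner)
  qed
  with mem have "lambda_min W = - M"
    unfolding lambda_min_def using finite_eigenvalues_symmetric[OF sym] by (intro Min_eqI) auto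
  then show "lambda_min W \<in> eigenvalues W" "lambda_min W * (norm x)\<^sup>2 \<le> x \<bullet> (W *v x)"
    using mem ge by auto
qed

lemma lambda_min_le_lambda_max:
  fixes W :: "real ^ 'n ^ 'n"
  assumes "transpose W = W"
  shows "lambda_min W \<le> lambda_max W"
  unfolding lambda_max_def
  using lambda_min_symmetric(1)[OF assms] finite_eigenvalues_symmetric[OF assms] by simp

section \<open>Spectral norm and extreme eigenvalues\<close>

lemma norm_matrix_vector_le_spectral_norm: "norm (W *v x) \<le> spectral_norm W * norm x"
  unfolding spectral_norm_def by (rule onorm[OF matrix_vector_mul_bounded_linear])

lemma abs_eigenvalue_le_spectral_norm:
  assumes "c \<in> eigenvalues W"
  shows "\<bar>c\<bar> \<le> spectral_norm W"
proof -
  obtain v where "v \<noteq> 0" "W *v v = c *\<^sub>R v"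
    using assms by (auto simp: eigenvalues_def)
  then show ?thesis
    using norm_matrix_vector_le_spectral_norm[of W v] by simp
qed

text \<open>The right-hand side is the larger of the absolute values of the two extreme eigenvalues.
  The numerical radius gives the upper bound, eigenvectors the lower one.\<close>

lemma spectral_norm_symmetric:
  fixes W :: "real ^ 'n ^ 'n"
  assumes sym: "transpose W = W"
  shows "spectral_norm W
    = \<bar>(lambda_max W + lambda_min W) / 2\<bar> + (lambda_max W - lambda_min W) / 2" (is "_ = ?K")
proof (rule antisym)
  have K: "?K = max \<bar>lambda_max W\<bar> \<bar>lambda_min W\<bar>"
    using lambda_min_le_lambda_max[OF sym] by (auto simp: max_def abs_if field_simps)
  show "spectral_norm W \<le> ?K"
    unfolding spectral_norm_def
  proof (rule onorm_le, rule symmetric_norm_le_numerical_radius[OF sym])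
    fix x :: "real ^ 'n"
    have "lambda_max W * (norm x)\<^sup>2 \<le> ?K * (norm x)\<^sup>2"
      unfolding K by (intro mult_right_mono) auto
    moreover have "- ?K * (norm x)\<^sup>2 \<le> lambda_min W * (norm x)\<^sup>2"
      unfolding K by (intro mult_right_mono) auto
    ultimately show "\<bar>x \<bullet> (W *v x)\<bar> \<le> ?K * (norm x)\<^sup>2"
      using lambda_max_symmetric(2)[OF sym, of x] lambda_min_symmetric(2)[OF sym, of x]
      by linarith
  qed
  show "?K \<le> spectral_norm W"
    unfolding K using lambda_max_symmetric(1)[OF sym] lambda_min_symmetric(1)[OF sym]
    by (simp add: abs_eigenvalue_le_spectral_norm)
qed

text \<open>Subtracting the midpoint times the identity centres the spectral interval at 0, so the
  numerical radius drops to the half-length.\<close>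

lemma norm_symmetric_minus_midpoint_le:
  fixes W :: "real ^ 'n ^ 'n"
  assumes sym: "transpose W = W"
  shows "norm (W *v x - ((lambda_max W + lambda_min W) / 2) *\<^sub>R x)
    \<le> (lambda_max W - lambda_min W) / 2 * norm x"
proof -
  let ?c = "(lambda_max W + lambda_min W) / 2"
  let ?S = "W - ?c *\<^sub>R mat 1"
  have S: "?S *v y = W *v y - ?c *\<^sub>R y" for y
    by (simp add: matrix_vector_mult_diff_rdistrib scaleR_matrix_vector_assoc[symmetric])
  have "transpose ?S = ?S"
    using sym by (simp add: transpose_def vec_eq_iff mat_def)
  then have "norm (?S *v x) \<le> (lambda_max W - lambda_min W) / 2 * norm x"
  proof (rule symmetric_norm_le_numerical_radius)
    fix y
    show "\<bar>y \<bullet> (?S *v y)\<bar> \<le> (lambda_max W - lambda_min W) / 2 * (norm y)\<^sup>2"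
      using lambda_max_symmetric(2)[OF sym, of y] lambda_min_symmetric(2)[OF sym, of y]
      unfolding S by (simp add: inner_diff_right power2_norm_eq_inner field_simps abs_le_iff)
  qed
  then show ?thesis unfolding S .
qed

section \<open>The function whose supremum is \<open>w0\<close>\<close>

text \<open>The sine of this angle is the function in \<^const>\<open>w0\<close>, with \<open>c\<close> and \<open>\<rho>\<close> the midpoint and
  half-length of the spectral interval.\<close>

definition anderson_angle :: "real \<Rightarrow> real \<Rightarrow> real \<Rightarrow> real"
  where "anderson_angle c \<rho> \<delta> = arcsin (\<rho> * \<delta> / sqrt (1 + (1 - c)\<^sup>2 * \<delta>\<^sup>2))
    + \<bar>arctan \<delta> - arctan ((1 - c) * \<delta>)\<bar>"

lemma cos_arctan_diff:
  "cos (arctan x - arctan y) = (1 + x * y) / (sqrt (1 + x\<^sup>2) * sqrt (1 + y\<^sup>2))"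
  by (simp add: cos_diff cos_arctan sin_arctan add_divide_distrib)

lemma sin_abs_arctan_diff:
  "sin \<bar>arctan x - arctan y\<bar> = \<bar>x - y\<bar> / (sqrt (1 + x\<^sup>2) * sqrt (1 + y\<^sup>2))"
proof -
  have pos: "sqrt (1 + x\<^sup>2) > 0" "sqrt (1 + y\<^sup>2) > 0"
    by (auto intro: add_pos_nonneg)
  have "sin (arctan x - arctan y) = (x - y) / (sqrt (1 + x\<^sup>2) * sqrt (1 + y\<^sup>2))"
    by (simp add: sin_diff cos_arctan sin_arctan diff_divide_distrib)
  moreover have "sin (arctan y - arctan x) = (y - x) / (sqrt (1 + x\<^sup>2) * sqrt (1 + y\<^sup>2))"
    by (simp add: sin_diff cos_arctan sin_arctan diff_divide_distrib mult.commute)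
  ultimately show ?thesis
    by (cases "x < y") (simp_all add: abs_if arctan_less_iff)
qed

text \<open>The interval with midpoint \<open>c\<close> and half-length \<rho> lies inside (-1, 1).
  All that is proved about the supremum needs only these two numbers; for a symmetric matrix
  \<open>\<bar>c\<bar> + \<rho>\<close> is the spectral norm.\<close>

locale spectral_interval =
  fixes c \<rho> :: real
  assumes rho_nonneg: "0 \<le> \<rho>" and sum_less_1: "\<bar>c\<bar> + \<rho> < 1"
begin

lemma rho_less: "\<rho> < 1 - c" and c_less: "0 < 1 - c"
  using rho_nonneg sum_less_1 by auto

lemma sqrt_pos [simp]: "0 < sqrt (1 + (1 - c)\<^sup>2 * \<delta>\<^sup>2)"
  by (auto intro: add_pos_nonneg)

lemma arcsin_arg:
  assumes "0 \<le> \<delta>"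
  shows "0 \<le> \<rho> * \<delta> / sqrt (1 + (1 - c)\<^sup>2 * \<delta>\<^sup>2)" "\<rho> * \<delta> / sqrt (1 + (1 - c)\<^sup>2 * \<delta>\<^sup>2) < 1"
proof -
  have "\<rho> * \<delta> \<le> (1 - c) * \<delta>"
    using rho_less assms by (intro mult_right_mono) auto
  also have "\<dots> = sqrt ((1 - c)\<^sup>2 * \<delta>\<^sup>2)"
    using c_less assms by (simp add: real_sqrt_mult)
  also have "\<dots> < sqrt (1 + (1 - c)\<^sup>2 * \<delta>\<^sup>2)"
    by simp
  finally show "\<rho> * \<delta> / sqrt (1 + (1 - c)\<^sup>2 * \<delta>\<^sup>2) < 1"
    by (subst pos_divide_less_eq[OF sqrt_pos]) simp
  show "0 \<le> \<rho> * \<delta> / sqrt (1 + (1 - c)\<^sup>2 * \<delta>\<^sup>2)"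
    using rho_nonneg assms by simp
qed

lemma sin_arcsin_part:
  assumes "0 \<le> \<delta>"
  shows "sin (arcsin (\<rho> * \<delta> / sqrt (1 + (1 - c)\<^sup>2 * \<delta>\<^sup>2))) = \<rho> * \<delta> / sqrt (1 + (1 - c)\<^sup>2 * \<delta>\<^sup>2)"
  using arcsin_arg[OF assms] by simp

lemma cos_arcsin_part:
  assumes "0 \<le> \<delta>"
  shows "cos (arcsin (\<rho> * \<delta> / sqrt (1 + (1 - c)\<^sup>2 * \<delta>\<^sup>2)))
    = sqrt (1 + ((1 - c)\<^sup>2 - \<rho>\<^sup>2) * \<delta>\<^sup>2) / sqrt (1 + (1 - c)\<^sup>2 * \<delta>\<^sup>2)"
proof -
  have "1 + (1 - c)\<^sup>2 * \<delta>\<^sup>2 > 0"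
    by (auto intro: add_pos_nonneg)
  then have "1 - (\<rho> * \<delta> / sqrt (1 + (1 - c)\<^sup>2 * \<delta>\<^sup>2))\<^sup>2
    = (1 + ((1 - c)\<^sup>2 - \<rho>\<^sup>2) * \<delta>\<^sup>2) / (1 + (1 - c)\<^sup>2 * \<delta>\<^sup>2)"
    by (simp add: power_divide power_mult_distrib diff_divide_eq_iff algebra_simps)
  then show ?thesis
    using arcsin_arg[OF assms] by (simp add: cos_arcsin real_sqrt_divide)
qed

lemma sqrt_ge_1: "1 \<le> sqrt (1 + ((1 - c)\<^sup>2 - \<rho>\<^sup>2) * \<delta>\<^sup>2)"
proof -
  have "\<rho>\<^sup>2 \<le> (1 - c)\<^sup>2"
    using rho_less rho_nonneg by (intro power_mono) auto
  then show ?thesis by simp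
qed

text \<open>Over a common denominator the numerator is nonnegative, because the root is at least 1
  and \<open>\<rho> * \<bar>c\<bar> \<le> \<rho> < 1 - c\<close>. This keeps the angle from being
  obtuse.\<close>

lemma cos_anderson_angle_nonneg:
  assumes d: "0 \<le> \<delta>"
  shows "0 \<le> cos (anderson_angle c \<rho> \<delta>)"
proof -
  let ?s = "sqrt (1 + (1 - c)\<^sup>2 * \<delta>\<^sup>2)" and ?r = "sqrt (1 + \<delta>\<^sup>2)"
  let ?t = "sqrt (1 + ((1 - c)\<^sup>2 - \<rho>\<^sup>2) * \<delta>\<^sup>2)"
  have "\<rho> * \<bar>c\<bar> \<le> \<rho> * 1"
    using rho_nonneg sum_less_1 by (intro mult_left_mono) auto
  then have "\<rho> * \<bar>c\<bar> * \<delta>\<^sup>2 \<le> (1 - c) * \<delta>\<^sup>2"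
    using rho_less by (intro mult_right_mono) auto
  also have "\<dots> \<le> 1 * (1 + (1 - c) * \<delta>\<^sup>2)"
    by simp
  also have "\<dots> \<le> ?t * (1 + (1 - c) * \<delta>\<^sup>2)"
    using sqrt_ge_1 c_less by (intro mult_right_mono) auto
  finally have "0 \<le> (?t * (1 + (1 - c) * \<delta>\<^sup>2) - \<rho> * \<bar>c\<bar> * \<delta>\<^sup>2) / (?s * ?s * ?r)"
    by (intro divide_nonneg_nonneg mult_nonneg_nonneg) auto
  also have "\<dots> = ?t / ?s * ((1 + \<delta> * ((1 - c) * \<delta>)) / (?r * ?s))
      - \<rho> * \<delta> / ?s * (\<bar>\<delta> - (1 - c) * \<delta>\<bar> / (?r * ?s))"
  proof -
    have "\<bar>\<delta> - (1 - c) * \<delta>\<bar> = \<bar>c\<bar> * \<delta>"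
      using d by (simp add: left_diff_distrib abs_mult)
    then show ?thesis
      by (simp add: diff_divide_distrib power2_eq_square mult_ac)
  qed
  also have "\<dots> = cos (anderson_angle c \<rho> \<delta>)"
    unfolding anderson_angle_def cos_add sin_arcsin_part[OF d] cos_arcsin_part[OF d]
      sin_abs_arctan_diff cos_abs_real cos_arctan_diff by (simp add: power_mult_distrib)
  finally show ?thesis .
qed

text \<open>Both terms of the addition formula contain
  \<open>\<delta> / sqrt (1 + \<delta>\<^sup>2)\<close>; splitting it off leaves a quotient to be
  compared with \<open>\<bar>c\<bar> + \<rho>\<close>.\<close>

lemma sin_anderson_angle:
  assumes d: "0 \<le> \<delta>"
  shows "sin (anderson_angle c \<rho> \<delta>)
    = (\<rho> * (1 + (1 - c) * \<delta>\<^sup>2) + \<bar>c\<bar> * sqrt (1 + ((1 - c)\<^sup>2 - \<rho>\<^sup>2) * \<delta>\<^sup>2))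
      / (1 + (1 - c)\<^sup>2 * \<delta>\<^sup>2) * (\<delta> / sqrt (1 + \<delta>\<^sup>2))"
proof -
  let ?s = "sqrt (1 + (1 - c)\<^sup>2 * \<delta>\<^sup>2)" and ?r = "sqrt (1 + \<delta>\<^sup>2)"
  let ?t = "sqrt (1 + ((1 - c)\<^sup>2 - \<rho>\<^sup>2) * \<delta>\<^sup>2)"
  have "\<bar>\<delta> - (1 - c) * \<delta>\<bar> = \<bar>c\<bar> * \<delta>"
    using d by (simp add: left_diff_distrib abs_mult)
  then have "sin (anderson_angle c \<rho> \<delta>) = \<rho> * \<delta> / ?s * ((1 + \<delta> * ((1 - c) * \<delta>)) / (?r * ?s))
      + ?t / ?s * (\<bar>c\<bar> * \<delta> / (?r * ?s))"
    unfolding anderson_angle_def sin_add sin_arcsin_part[OF d] cos_arcsin_part[OF d]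
      sin_abs_arctan_diff cos_abs_real cos_arctan_diff by (simp add: power_mult_distrib)
  also have "\<dots> = (\<rho> * (1 + (1 - c) * \<delta>\<^sup>2) + \<bar>c\<bar> * ?t) / (?s * ?s) * (\<delta> / ?r)"
  proof -
    have "\<rho> * \<delta> / s * ((1 + \<delta> * ((1 - c) * \<delta>)) / (r * s)) + t / s * (\<bar>c\<bar> * \<delta> / (r * s))
        = (\<rho> * (1 + (1 - c) * \<delta>\<^sup>2) + \<bar>c\<bar> * t) / (s * s) * (\<delta> / r)" for r s t
      by (simp add: power2_eq_square add_divide_distrib[symmetric] divide_divide_eq_left
          times_divide_times_eq) (simp add: algebra_simps)
    then show ?thesis .
  qed
  also have "?s * ?s = 1 + (1 - c)\<^sup>2 * \<delta>\<^sup>2"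
    by simp
  finally show ?thesis .
qed

lemma sin_anderson_angle_le:
  assumes d: "0 \<le> \<delta>"
  shows "sin (anderson_angle c \<rho> \<delta>) \<le> (\<bar>c\<bar> + \<rho>) * (\<delta> / sqrt (1 + \<delta>\<^sup>2))"
proof -
  define A x t where "A = 1 - c" and "x = \<delta>\<^sup>2" and "t = sqrt (1 + (A\<^sup>2 - \<rho>\<^sup>2) * x)"
  have x: "0 \<le> x" and A: "\<rho> < A" "0 < A"
    using rho_less c_less by (auto simp: x_def A_def)
  have c: "c = 1 - A" by (simp add: A_def)
  have AA: "\<rho>\<^sup>2 \<le> A\<^sup>2"
    using A rho_nonneg by (intro power_mono) auto
  \<comment> \<open>What remains of the claim after \<open>A = A\<^sup>2 + A * c\<close> is used in
    the term with \<rho>. For \<open>c \<ge> 0\<close> the factor \<open>c\<close> cancels and the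
    root is compared with a perfect square; for \<open>c < 0\<close> the mixed term has the
    favourable sign.\<close>
  have main: "\<bar>c\<bar> * t \<le> \<bar>c\<bar> * (1 + A\<^sup>2 * x) - \<rho> * A * c * x"
  proof (cases "0 \<le> c")
    case True
    have "1 + (A\<^sup>2 - \<rho>\<^sup>2) * x \<le> (1 + A * (A - \<rho>) * x)\<^sup>2"
    proof -
      have "(A\<^sup>2 - \<rho>\<^sup>2) * x = (A + \<rho>) * (A - \<rho>) * x"
        by (simp add: power2_eq_square algebra_simps)
      also have "\<dots> \<le> (2 * A) * (A - \<rho>) * x"
        using A x by (intro mult_right_mono) auto
      also have "1 + 2 * A * (A - \<rho>) * x \<le> (1 + A * (A - \<rho>) * x)\<^sup>2"
        by (simp add: power2_sum)
      finally show ?thesis by simp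
    qed
    moreover have "0 \<le> 1 + A * (A - \<rho>) * x"
      using A x by simp
    ultimately have "t \<le> 1 + A * (A - \<rho>) * x"
      unfolding t_def by (rule real_le_lsqrt[rotated])
    then have "c * t \<le> c * (1 + A * (A - \<rho>) * x)"
      using True by (rule mult_left_mono)
    then show ?thesis
      using True by (simp add: algebra_simps power2_eq_square)
  next
    case False
    have "1 + (A\<^sup>2 - \<rho>\<^sup>2) * x \<le> 1 + A\<^sup>2 * x"
      using x by (simp add: mult_right_mono)
    also have "\<dots> \<le> (1 + A\<^sup>2 * x)\<^sup>2"
      using x by (intro self_le_power) auto
    finally have "t \<le> 1 + A\<^sup>2 * x"
      unfolding t_def using x by (intro real_le_lsqrt) auto
    then have "\<bar>c\<bar> * t \<le> \<bar>c\<bar> * (1 + A\<^sup>2 * x)"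
      by (rule mult_left_mono) simp
    moreover have "\<rho> * A * c * x \<le> 0"
      using False A x rho_nonneg by (intro mult_nonpos_nonneg mult_nonneg_nonpos) auto
    ultimately show ?thesis by linarith
  qed
  have "\<rho> * (1 + A * x) + \<bar>c\<bar> * t \<le> (\<bar>c\<bar> + \<rho>) * (1 + A\<^sup>2 * x)"
  proof -
    have "\<rho> * (1 + A * x) = \<rho> * (1 + A\<^sup>2 * x) + \<rho> * A * c * x"
      by (simp add: c power2_eq_square algebra_simps)
    then show ?thesis using main by (simp add: algebra_simps)
  qed
  then have "(\<rho> * (1 + A * x) + \<bar>c\<bar> * t) / (1 + A\<^sup>2 * x) \<le> \<bar>c\<bar> + \<rho>"
    using x by (subst pos_divide_le_eq) (auto intro: add_pos_nonneg)
  then show ?thesis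
    unfolding sin_anderson_angle[OF d]
    using d by (intro mult_right_mono) (auto simp: A_def x_def t_def)
qed

text \<open>Both arctangents tend to pi / 2 because \<open>1 - c\<close> is positive, so only the
  arcsine part survives. It stays below pi / 2, where arcsine is continuous.\<close>

lemma tendsto_sin_anderson_angle:
  "((\<lambda>\<delta>. sin (anderson_angle c \<rho> \<delta>)) \<longlongrightarrow> \<rho> / (1 - c)) at_top"
proof -
  have lim: "((\<lambda>\<delta>::real. \<delta> / sqrt (1 + A\<^sup>2 * \<delta>\<^sup>2)) \<longlongrightarrow> 1 / A) at_top" if "0 < A" for A
    using that by real_asymp (simp add: divide_inverse)
  have "((\<lambda>\<delta>. \<rho> * (\<delta> / sqrt (1 + (1 - c)\<^sup>2 * \<delta>\<^sup>2))) \<longlongrightarrow> \<rho> * (1 / (1 - c))) at_top"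
    by (intro tendsto_mult tendsto_const lim c_less)
  then have "((\<lambda>\<delta>. \<rho> * \<delta> / sqrt (1 + (1 - c)\<^sup>2 * \<delta>\<^sup>2)) \<longlongrightarrow> \<rho> / (1 - c)) at_top"
    by simp
  moreover have lt: "\<rho> / (1 - c) < 1" "0 \<le> \<rho> / (1 - c)"
    using rho_less c_less rho_nonneg by auto
  then have "isCont arcsin (\<rho> / (1 - c))"
    by (intro isCont_arcsin) auto
  ultimately have arcsin: "((\<lambda>\<delta>. arcsin (\<rho> * \<delta> / sqrt (1 + (1 - c)\<^sup>2 * \<delta>\<^sup>2)))
      \<longlongrightarrow> arcsin (\<rho> / (1 - c))) at_top"
    by (rule isCont_tendsto_compose[rotated])
  have "((\<lambda>\<delta>. arctan ((1 - c) * \<delta>)) \<longlongrightarrow> pi / 2) at_top"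
    using c_less by (intro filterlim_compose[OF tendsto_arctan_at_top]
        filterlim_tendsto_pos_mult_at_top[OF tendsto_const] filterlim_ident)
  with tendsto_arctan_at_top
  have "((\<lambda>\<delta>. \<bar>arctan \<delta> - arctan ((1 - c) * \<delta>)\<bar>) \<longlongrightarrow> \<bar>pi / 2 - pi / 2\<bar>) at_top"
    by (intro tendsto_rabs tendsto_diff)
  with arcsin have "((\<lambda>\<delta>. sin (anderson_angle c \<rho> \<delta>))
      \<longlongrightarrow> sin (arcsin (\<rho> / (1 - c)) + \<bar>pi / 2 - pi / 2\<bar>)) at_top"
    unfolding anderson_angle_def by (intro tendsto_sin tendsto_add)
  then show ?thesis
    using lt by simp
qed

section \<open>The supremum over the parameter\<close>

lemma Sup_sin_anderson_angle_upper:
  "0 \<le> \<delta> \<Longrightarrow> sin (anderson_angle c \<rho> \<delta>) \<le> (SUP \<delta>\<in>{0..}. sin (anderson_angle c \<rho> \<delta>))"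
  by (intro cSUP_upper bdd_aboveI2[where M = 1]) auto

lemma Sup_sin_anderson_angle_nonneg:
  "0 \<le> (SUP \<delta>\<in>{0..}. sin (anderson_angle c \<rho> \<delta>))"
  using Sup_sin_anderson_angle_upper[of 0] by (simp add: anderson_angle_def)

text \<open>Stands in for the parameter value infinity, which the supremum does not range
  over.\<close>

lemma Sup_sin_anderson_angle_ge_limit:
  "\<rho> / (1 - c) \<le> (SUP \<delta>\<in>{0..}. sin (anderson_angle c \<rho> \<delta>))"
  by (intro tendsto_upperbound[OF tendsto_sin_anderson_angle]
      eventually_mono[OF eventually_ge_at_top[of 0]] Sup_sin_anderson_angle_upper) auto

lemma sin_anderson_angle_le_sum:
  assumes d: "0 \<le> \<delta>"
  shows "sin (anderson_angle c \<rho> \<delta>) \<le> \<bar>c\<bar> + \<rho>"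
proof -
  have "\<delta> \<le> sqrt (1 + \<delta>\<^sup>2)"
    using d by (intro real_le_rsqrt) auto
  then have "\<delta> / sqrt (1 + \<delta>\<^sup>2) \<le> 1"
    by (simp add: divide_le_eq add_pos_nonneg)
  then have "(\<bar>c\<bar> + \<rho>) * (\<delta> / sqrt (1 + \<delta>\<^sup>2)) \<le> (\<bar>c\<bar> + \<rho>) * 1"
    using rho_nonneg by (intro mult_left_mono) auto
  with sin_anderson_angle_le[OF d] show ?thesis by simp
qed

lemma Sup_sin_anderson_angle_le:
  "(SUP \<delta>\<in>{0..}. sin (anderson_angle c \<rho> \<delta>)) \<le> \<bar>c\<bar> + \<rho>"
  by (intro cSUP_least sin_anderson_angle_le_sum) auto

lemma Sup_sin_anderson_angle_less:
  assumes "c \<noteq> 0"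
  shows "(SUP \<delta>\<in>{0..}. sin (anderson_angle c \<rho> \<delta>)) < \<bar>c\<bar> + \<rho>"
proof -
  have "\<rho> / (1 - c) < \<bar>c\<bar> + \<rho>"
  proof (cases "0 < c")
    case True
    \<comment> \<open>This product equals \<open>(c + \<rho>) * (1 - c) - \<rho>\<close>.\<close>
    have "0 < c * (1 - (c + \<rho>))"
      using True sum_less_1 by simp
    then show ?thesis
      using True c_less by (simp add: pos_divide_less_eq algebra_simps)
  next
    case False
    then have "\<rho> / (1 - c) \<le> \<rho>"
      using rho_nonneg by (simp add: pos_divide_le_eq mult_nonneg_nonpos algebra_simps)
    then show ?thesis using assms by simp
  qed
  then obtain b where b: "\<rho> / (1 - c) < b" "b < \<bar>c\<bar> + \<rho>"
    using dense by blast
  then have "eventually (\<lambda>\<delta>. sin (anderson_angle c \<rho> \<delta>) < b) at_top"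
    using order_tendstoD(2)[OF tendsto_sin_anderson_angle] by blast
  then obtain D where D: "\<And>\<delta>. D \<le> \<delta> \<Longrightarrow> sin (anderson_angle c \<rho> \<delta>) < b"
    by (auto simp: eventually_at_top_linorder)
  define E where "E = max D 0"
  \<comment> \<open>On [0, E] the bound
    \<open>(\<bar>c\<bar> + \<rho>) * sin (arctan \<delta>)\<close> increases, so its value at
    \<open>E\<close> dominates; beyond \<open>E\<close> the number \<open>b\<close> does.\<close>
  define b' where "b' = (\<bar>c\<bar> + \<rho>) * sin (arctan E)"
  have "sin (arctan E) < 1"
    using arctan_bounded[of E] sin_monotone_2pi[of "arctan E" "pi / 2"] by simp
  then have b': "b' < \<bar>c\<bar> + \<rho>"
    using mult_strict_left_mono[of "sin (arctan E)" 1 "\<bar>c\<bar> + \<rho>"] assms rho_nonneg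
    by (simp add: b'_def add_pos_nonneg)
  have "sin (anderson_angle c \<rho> \<delta>) \<le> max b b'" if d: "0 \<le> \<delta>" for \<delta>
  proof (cases "E \<le> \<delta>")
    case True
    then show ?thesis using D[of \<delta>] by (simp add: E_def)
  next
    case False
    have "sin (arctan \<delta>) \<le> sin (arctan E)"
      using False arctan_bounded[of \<delta>] arctan_bounded[of E]
      by (intro sin_monotone_2pi_le) (auto simp: arctan_le_iff)
    then have "(\<bar>c\<bar> + \<rho>) * (\<delta> / sqrt (1 + \<delta>\<^sup>2)) \<le> b'"
      unfolding b'_def sin_arctan[of \<delta>, symmetric] using rho_nonneg by (intro mult_left_mono) auto
    with sin_anderson_angle_le[OF d] show ?thesis by simp
  qed
  then have "(SUP \<delta>\<in>{0..}. sin (anderson_angle c \<rho> \<delta>)) \<le> max b b'"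
    by (intro cSUP_least) auto
  also have "\<dots> < \<bar>c\<bar> + \<rho>"
    using b b' by simp
  finally show ?thesis .
qed

lemma Sup_sin_anderson_angle_eq_iff:
  "(SUP \<delta>\<in>{0..}. sin (anderson_angle c \<rho> \<delta>)) = \<bar>c\<bar> + \<rho> \<longleftrightarrow> c = 0"
proof
  assume "c = 0"
  \<comment> \<open>For \<open>c = 0\<close> the limit at infinity is \<rho>, which is already the
    upper bound.\<close>
  then show "(SUP \<delta>\<in>{0..}. sin (anderson_angle c \<rho> \<delta>)) = \<bar>c\<bar> + \<rho>"
    using Sup_sin_anderson_angle_le Sup_sin_anderson_angle_ge_limit by simp
qed (use Sup_sin_anderson_angle_less in force)

end

section \<open>Distance from the origin to a line\<close>

text \<open>Triangle inequality for angles. Split \<open>a\<close> and \<open>c\<close> into parts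
  along \<open>b\<close> and orthogonal to it; the orthogonal parts have lengths
  \<open>sin \<beta>\<close> and \<open>sin \<phi>\<close>, and Cauchy-Schwarz bounds their inner
  product from below.\<close>

lemma inner_ge_cos_add:
  fixes a b c :: "'a::real_inner"
  assumes unit: "norm a = 1" "norm b = 1" "norm c = 1"
    and ab: "a \<bullet> b = cos \<beta>" and bc: "cos \<alpha> \<le> b \<bullet> c"
    and range: "0 \<le> \<alpha>" "0 \<le> \<beta>" "\<alpha> + \<beta> \<le> pi"
  shows "cos (\<alpha> + \<beta>) \<le> a \<bullet> c"
proof -
  define \<phi> where "\<phi> = arccos (b \<bullet> c)"
  have abs: "\<bar>b \<bullet> c\<bar> \<le> 1"
    using Cauchy_Schwarz_ineq2[of b c] unit by simp
  then have cos: "b \<bullet> c = cos \<phi>" and \<phi>: "0 \<le> \<phi>" "\<phi> \<le> pi"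
    using arccos_lbound[of "b \<bullet> c"] arccos_ubound[of "b \<bullet> c"] by (auto simp: \<phi>_def abs_le_iff)
  have "\<phi> \<le> \<alpha>"
    using bc \<phi> range cos_mono_le_eq[of \<alpha> \<phi>] by (simp add: cos)
  have sq: "a \<bullet> a = 1" "b \<bullet> b = 1" "c \<bullet> c = 1"
    using unit by (simp_all add: norm_eq_1)
  have "(norm (a - cos \<beta> *\<^sub>R b))\<^sup>2 = (sin \<beta>)\<^sup>2"
    unfolding power2_norm_eq_inner sin_squared_eq
    by (simp add: inner_diff_left inner_diff_right sq ab inner_commute[of b a] power2_eq_square)
  then have na: "norm (a - cos \<beta> *\<^sub>R b) = sin \<beta>"
    using range by (simp add: power2_eq_iff_nonneg sin_ge_zero)
  have "(norm (c - cos \<phi> *\<^sub>R b))\<^sup>2 = (sin \<phi>)\<^sup>2"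
    unfolding power2_norm_eq_inner sin_squared_eq
    by (simp add: inner_diff_left inner_diff_right sq cos inner_commute[of c b] power2_eq_square)
  then have nc: "norm (c - cos \<phi> *\<^sub>R b) = sin \<phi>"
    using \<phi> by (simp add: power2_eq_iff_nonneg sin_ge_zero)
  have "- (sin \<beta> * sin \<phi>) \<le> (a - cos \<beta> *\<^sub>R b) \<bullet> (c - cos \<phi> *\<^sub>R b)"
    using Cauchy_Schwarz_ineq2[of "a - cos \<beta> *\<^sub>R b" "c - cos \<phi> *\<^sub>R b"] by (simp add: na nc abs_le_iff)
  also have "\<dots> = a \<bullet> c - cos \<beta> * cos \<phi>"
    by (simp add: inner_diff_left inner_diff_right sq ab cos algebra_simps)
  finally have "cos (\<phi> + \<beta>) \<le> a \<bullet> c"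
    by (simp add: cos_add mult.commute)
  moreover have "cos (\<alpha> + \<beta>) \<le> cos (\<phi> + \<beta>)"
    using \<phi> range \<open>\<phi> \<le> \<alpha>\<close> by (intro cos_monotone_0_pi_le) auto
  ultimately show ?thesis by linarith
qed

text \<open>The angle between \<open>u\<close> and \<open>d\<close> is at most \<theta>, so
  projecting \<open>u\<close> orthogonally onto the line of \<open>d\<close> leaves at most
  \<open>norm u * sin \<theta>\<close>.\<close>

lemma exists_norm_diff_le_sin:
  fixes u d :: "'a::real_inner"
  assumes d: "d \<noteq> 0" and \<theta>: "0 \<le> \<theta>" "\<theta> \<le> pi / 2" and le: "norm u * norm d * cos \<theta> \<le> u \<bullet> d"
  shows "\<exists>t. norm (u - t *\<^sub>R d) \<le> norm u * sin \<theta>"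
proof
  let ?t = "(u \<bullet> d) / (norm d)\<^sup>2"
  have D: "0 < (norm d)\<^sup>2"
    using d by simp
  \<comment> \<open>The sign is what allows the hypothesis to be squared.\<close>
  have "0 \<le> norm u * norm d * cos \<theta>"
    using \<theta> pi_ge_zero by (intro mult_nonneg_nonneg norm_ge_zero cos_ge_zero) linarith+
  with le have "(norm u * norm d * cos \<theta>)\<^sup>2 \<le> (u \<bullet> d)\<^sup>2"
    by (intro power_mono) auto
  then have "(norm u * cos \<theta>)\<^sup>2 * (norm d)\<^sup>2 \<le> (u \<bullet> d)\<^sup>2"
    by (simp add: power_mult_distrib mult_ac)
  then have le2: "(norm u * cos \<theta>)\<^sup>2 \<le> (u \<bullet> d)\<^sup>2 / (norm d)\<^sup>2"
    unfolding pos_le_divide_eq[OF D] .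
  have "(norm (u - ?t *\<^sub>R d))\<^sup>2 = (norm u)\<^sup>2 - 2 * ?t * (u \<bullet> d) + ?t * (?t * (norm d)\<^sup>2)"
    unfolding power2_norm_eq_inner inner_diff_left inner_diff_right inner_scaleR_left
      inner_scaleR_right inner_commute[of d u] by simp
  also have "?t * (norm d)\<^sup>2 = u \<bullet> d"
    using d by simp
  also have "(norm u)\<^sup>2 - 2 * ?t * (u \<bullet> d) + ?t * (u \<bullet> d) = (norm u)\<^sup>2 - (u \<bullet> d)\<^sup>2 / (norm d)\<^sup>2"
    unfolding power2_eq_square[of "u \<bullet> d"] by simp
  also have "\<dots> \<le> (norm u * sin \<theta>)\<^sup>2"
  proof -
    have "(norm u * cos \<theta>)\<^sup>2 + (norm u * sin \<theta>)\<^sup>2 = (norm u)\<^sup>2"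
      unfolding power_mult_distrib distrib_left[symmetric] by simp
    with le2 show ?thesis by linarith
  qed
  finally show "norm (u - ?t *\<^sub>R d) \<le> norm u * sin \<theta>"
    by (rule power2_le_imp_le) (use \<theta> pi_ge_zero in \<open>intro mult_nonneg_nonneg norm_ge_zero sin_ge_zero; linarith\<close>)
qed

text \<open>A relative perturbation of size \<sigma> turns a vector by at most
  \<open>arcsin \<sigma>\<close>. After squaring this is the inequality of arithmetic and geometric
  means for \<open>v \<bullet> v - e \<bullet> e\<close> and
  \<open>(v - e) \<bullet> (v - e)\<close>, whose mean is
  \<open>v \<bullet> (v - e)\<close>.\<close>

lemma inner_perturbation_ge:
  fixes v e :: "'a::real_inner"
  assumes e: "norm e \<le> \<sigma> * norm v" and s: "0 \<le> \<sigma>" "\<sigma> \<le> 1"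
  shows "norm v * norm (v - e) * sqrt (1 - \<sigma>\<^sup>2) \<le> v \<bullet> (v - e)"
proof (rule power2_le_imp_le)
  have "(norm e)\<^sup>2 \<le> (\<sigma> * norm v)\<^sup>2"
    using e by (intro power_mono) auto
  then have ee: "\<sigma>\<^sup>2 * (v \<bullet> v) \<ge> e \<bullet> e"
    by (simp add: power2_norm_eq_inner power_mult_distrib)
  have "v \<bullet> e \<le> norm v * norm e"
    by (rule norm_cauchy_schwarz)
  also have "\<dots> \<le> norm v * (1 * norm v)"
    using s by (intro mult_left_mono order_trans[OF e] mult_right_mono) auto
  finally show "0 \<le> v \<bullet> (v - e)"
    by (simp add: inner_diff_right power2_norm_eq_inner[symmetric] power2_eq_square)
  have am_gm: "x * y \<le> ((x + y) / 2)\<^sup>2" for x y :: real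
    using sum_squares_ge_zero[of "x - y" 0] by (simp add: power2_eq_square field_simps)
  have "(norm v * norm (v - e) * sqrt (1 - \<sigma>\<^sup>2))\<^sup>2 = (v \<bullet> v - \<sigma>\<^sup>2 * (v \<bullet> v)) * ((v - e) \<bullet> (v - e))"
    using s by (simp add: power_mult_distrib power2_norm_eq_inner abs_square_le_1 algebra_simps)
  also have "\<dots> \<le> (v \<bullet> v - e \<bullet> e) * ((v - e) \<bullet> (v - e))"
    using ee by (intro mult_right_mono) auto
  also have "\<dots> \<le> (((v \<bullet> v - e \<bullet> e) + ((v - e) \<bullet> (v - e))) / 2)\<^sup>2"
    by (rule am_gm)
  also have "((v \<bullet> v - e \<bullet> e) + ((v - e) \<bullet> (v - e))) / 2 = v \<bullet> (v - e)"
    by (simp add: inner_diff_left inner_diff_right inner_commute)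
  finally show "(norm v * norm (v - e) * sqrt (1 - \<sigma>\<^sup>2))\<^sup>2 \<le> (v \<bullet> (v - e))\<^sup>2" .
qed

section \<open>The angle bound for the line through two residuals\<close>

context spectral_interval
begin

text \<open>The two parts sum to less than pi, and in that range a nonnegative cosine excludes
  obtuse angles.\<close>

lemma anderson_angle_bounds:
  assumes d: "0 \<le> \<delta>"
  shows "0 \<le> anderson_angle c \<rho> \<delta>" "anderson_angle c \<rho> \<delta> \<le> pi / 2"
proof -
  let ?\<alpha> = "arcsin (\<rho> * \<delta> / sqrt (1 + (1 - c)\<^sup>2 * \<delta>\<^sup>2))"
  let ?\<beta> = "\<bar>arctan \<delta> - arctan ((1 - c) * \<delta>)\<bar>"
  have \<alpha>: "0 \<le> ?\<alpha>" "?\<alpha> \<le> pi / 2"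
    using arcsin_arg[OF d] arcsin_le_arcsin[of 0 "\<rho> * \<delta> / sqrt (1 + (1 - c)\<^sup>2 * \<delta>\<^sup>2)"]
      arcsin_ubound[of "\<rho> * \<delta> / sqrt (1 + (1 - c)\<^sup>2 * \<delta>\<^sup>2)"] by auto
  have "0 \<le> arctan \<delta>" "0 \<le> arctan ((1 - c) * \<delta>)"
    using d c_less by auto
  then have \<beta>: "?\<beta> < pi / 2"
    using arctan_ubound[of \<delta>] arctan_ubound[of "(1 - c) * \<delta>"] by linarith
  show "0 \<le> anderson_angle c \<rho> \<delta>"
    using \<alpha> by (simp add: anderson_angle_def)
  show "anderson_angle c \<rho> \<delta> \<le> pi / 2"
  proof (rule ccontr)
    assume "\<not> ?thesis"
    moreover have "anderson_angle c \<rho> \<delta> < pi"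
      using \<alpha> \<beta> by (simp add: anderson_angle_def)
    ultimately have "cos (anderson_angle c \<rho> \<delta>) < cos (pi / 2)"
      by (intro cos_monotone_0_pi) auto
    then show False
      using cos_anderson_angle_nonneg[OF d] by simp
  qed
qed

text \<open>The line through \<open>p + s\<close> and \<open>w\<close> has direction \<open>d0 - e\<close> with \<open>d0 = (1 - c) p + s\<close> and
  \<open>e = w - c p\<close>. The angle between \<open>p + s\<close> and \<open>d0\<close> is the arctangent part of
  \<open>anderson_angle c \<rho> \<delta>\<close>, and the angle between \<open>d0\<close> and \<open>d0 - e\<close> at most the arcsine part.\<close>

lemma exists_norm_affine_combination_le:
  fixes p s w :: "'a::real_inner"
  assumes orth: "p \<bullet> s = 0" and w: "norm (w - c *\<^sub>R p) \<le> \<rho> * norm p"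
  shows "\<exists>t. norm ((p + s) - t *\<^sub>R ((p + s) - w))
    \<le> (SUP \<delta>\<in>{0..}. sin (anderson_angle c \<rho> \<delta>)) * norm (p + s)"
proof (cases "s = 0")
  case True
  \<comment> \<open>The parameter \<open>1 / (1 - c)\<close> cancels the component of
    \<open>w\<close> along \<open>p\<close> that the midpoint predicts; only the deviation
    \<open>w - c *\<^sub>R p\<close> is left.\<close>
  have "(p + s) - (1 / (1 - c)) *\<^sub>R ((p + s) - w) = (1 / (1 - c)) *\<^sub>R (w - c *\<^sub>R p)"
  proof -
    have "p = (1 / (1 - c)) *\<^sub>R ((1 - c) *\<^sub>R p)"
      using c_less by simp
    then have "(p + s) - (1 / (1 - c)) *\<^sub>R ((p + s) - w)
        = (1 / (1 - c)) *\<^sub>R ((1 - c) *\<^sub>R p - (p - w))"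
      using True by (metis add.right_neutral scaleR_right_diff_distrib)
    then show ?thesis
      by (simp add: scaleR_left_diff_distrib)
  qed
  then have "norm ((p + s) - (1 / (1 - c)) *\<^sub>R ((p + s) - w)) = norm (w - c *\<^sub>R p) / (1 - c)"
    using c_less by simp
  also have "\<dots> \<le> \<rho> * norm p / (1 - c)"
    using w c_less by (intro divide_right_mono) auto
  also have "\<dots> = \<rho> / (1 - c) * norm (p + s)"
    using True by simp
  also have "\<dots> \<le> (SUP \<delta>\<in>{0..}. sin (anderson_angle c \<rho> \<delta>)) * norm (p + s)"
    by (intro mult_right_mono Sup_sin_anderson_angle_ge_limit) simp
  finally show ?thesis by blast
next
  case False
  define \<delta> where "\<delta> = norm p / norm s"
  have \<delta>: "0 \<le> \<delta>" by (simp add: \<delta>_def)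
  have ns: "0 < norm s" using False by simp
  have np: "norm p = \<delta> * norm s" using ns by (simp add: \<delta>_def)
  define e d0 where "e = w - c *\<^sub>R p" and "d0 = (1 - c) *\<^sub>R p + s"
  define \<sigma> where "\<sigma> = \<rho> * \<delta> / sqrt (1 + (1 - c)\<^sup>2 * \<delta>\<^sup>2)"
  define \<beta> where "\<beta> = \<bar>arctan \<delta> - arctan ((1 - c) * \<delta>)\<bar>"
  have d: "(p + s) - w = d0 - e"
    by (simp add: d0_def e_def scaleR_left_diff_distrib)
  have "(norm (p + s))\<^sup>2 = (sqrt (1 + \<delta>\<^sup>2) * norm s)\<^sup>2"
  proof -
    have "(norm (p + s))\<^sup>2 = (norm p)\<^sup>2 + (norm s)\<^sup>2"
      using orth by (simp add: power2_norm_eq_inner inner_add_left inner_add_right inner_commute)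
    then show ?thesis
      by (simp add: np power_mult_distrib algebra_simps)
  qed
  then have nu: "norm (p + s) = sqrt (1 + \<delta>\<^sup>2) * norm s"
    by (simp add: power2_eq_iff_nonneg)
  have "(norm d0)\<^sup>2 = (sqrt (1 + (1 - c)\<^sup>2 * \<delta>\<^sup>2) * norm s)\<^sup>2"
  proof -
    have "(norm d0)\<^sup>2 = (1 - c)\<^sup>2 * (norm p)\<^sup>2 + (norm s)\<^sup>2"
      using orth unfolding d0_def
      by (simp add: power2_norm_eq_inner inner_add_left inner_add_right inner_commute[of s p]
          power2_eq_square[of "1 - c"] mult.assoc)
    also have "\<dots> = (1 + (1 - c)\<^sup>2 * \<delta>\<^sup>2) * (norm s)\<^sup>2"
      by (simp add: np power_mult_distrib distrib_right mult.assoc)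
    finally show ?thesis
      by (simp add: power_mult_distrib)
  qed
  then have nd0: "norm d0 = sqrt (1 + (1 - c)\<^sup>2 * \<delta>\<^sup>2) * norm s"
    by (simp add: power2_eq_iff_nonneg)
  have pos: "0 < sqrt (1 + \<delta>\<^sup>2)" "0 < sqrt (1 + (1 - c)\<^sup>2 * \<delta>\<^sup>2)"
    by (auto intro: add_pos_nonneg)
  have d0_pos: "0 < norm d0" and u_pos: "0 < norm (p + s)"
    unfolding nd0 nu using ns pos by (metis mult_pos_pos)+
  \<comment> \<open>Here \<sigma> is exactly the ratio of \<open>\<rho> * norm p\<close> to
    \<open>norm d0\<close>.\<close>
  have "norm e \<le> \<sigma> * norm d0"
    using w pos(2) by (simp add: e_def nd0 \<sigma>_def np)
  then have pert: "norm d0 * norm (d0 - e) * sqrt (1 - \<sigma>\<^sup>2) \<le> d0 \<bullet> (d0 - e)"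
    using arcsin_arg[OF \<delta>] by (intro inner_perturbation_ge) (auto simp: \<sigma>_def)
  have "\<sigma> < 1" "0 \<le> \<sigma>"
    using arcsin_arg[OF \<delta>] by (auto simp: \<sigma>_def)
  \<comment> \<open>The line is nondegenerate: as \<sigma> < 1, \<open>e\<close> is shorter than
    \<open>d0\<close>.\<close>
  have "d0 - e \<noteq> 0"
  proof
    assume "d0 - e = 0"
    then have "norm d0 \<le> \<sigma> * norm d0"
      using \<open>norm e \<le> \<sigma> * norm d0\<close> by simp
    then show False
      using \<open>\<sigma> < 1\<close> d0_pos by simp
  qed
  have "cos (arcsin \<sigma> + \<beta>) \<le> sgn (p + s) \<bullet> sgn (d0 - e)"
  proof (rule inner_ge_cos_add[where b = "sgn d0"])
    show "norm (sgn (p + s)) = 1" "norm (sgn d0) = 1" "norm (sgn (d0 - e)) = 1"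
      using \<open>d0 - e \<noteq> 0\<close> d0_pos u_pos by (auto simp: norm_sgn)
    have "(p + s) \<bullet> d0 = (1 + \<delta> * ((1 - c) * \<delta>)) * (norm s)\<^sup>2"
    proof -
      have "(p + s) \<bullet> d0 = (1 - c) * (norm p)\<^sup>2 + (norm s)\<^sup>2"
        using orth unfolding d0_def
        by (simp add: power2_norm_eq_inner inner_add_left inner_add_right inner_commute[of s p])
      then show ?thesis
        by (simp add: np power2_eq_square algebra_simps)
    qed
    moreover have "sgn (p + s) \<bullet> sgn d0 = ((p + s) \<bullet> d0) / (norm (p + s) * norm d0)"
      by (simp add: sgn_div_norm divide_inverse mult_ac)
    ultimately have "sgn (p + s) \<bullet> sgn d0 = (1 + \<delta> * ((1 - c) * \<delta>)) * (norm s)\<^sup>2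
        / ((sqrt (1 + \<delta>\<^sup>2) * norm s) * (sqrt (1 + (1 - c)\<^sup>2 * \<delta>\<^sup>2) * norm s))"
      by (simp only: nu nd0)
    also have "\<dots> = (1 + \<delta> * ((1 - c) * \<delta>)) / (sqrt (1 + \<delta>\<^sup>2) * sqrt (1 + (1 - c)\<^sup>2 * \<delta>\<^sup>2))"
      using False by (simp add: power2_eq_square[of "norm s"])
    also have "\<dots> = cos \<beta>"
      by (simp only: \<beta>_def cos_abs_real cos_arctan_diff power_mult_distrib)
    finally show "sgn (p + s) \<bullet> sgn d0 = cos \<beta>" .
    show "cos (arcsin \<sigma>) \<le> sgn d0 \<bullet> sgn (d0 - e)"
      using pert \<open>d0 - e \<noteq> 0\<close> d0_pos \<open>\<sigma> < 1\<close> \<open>0 \<le> \<sigma>\<close>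
      by (simp add: cos_arcsin sgn_div_norm divide_simps mult_ac)
    show "0 \<le> arcsin \<sigma>"
      using arcsin_le_arcsin[of 0 \<sigma>] \<open>\<sigma> < 1\<close> \<open>0 \<le> \<sigma>\<close> by simp
    show "0 \<le> \<beta>" by (simp add: \<beta>_def)
    show "arcsin \<sigma> + \<beta> \<le> pi"
      using anderson_angle_bounds(2)[OF \<delta>] pi_ge_zero
      unfolding anderson_angle_def \<sigma>_def \<beta>_def by linarith
  qed
  then have "norm (p + s) * norm (d0 - e) * cos (anderson_angle c \<rho> \<delta>) \<le> (p + s) \<bullet> (d0 - e)"
    using \<open>d0 - e \<noteq> 0\<close> u_pos
    by (simp add: anderson_angle_def \<sigma>_def \<beta>_def sgn_div_norm divide_simps mult_ac)
  then obtain t where "norm ((p + s) - t *\<^sub>R (d0 - e)) \<le> norm (p + s) * sin (anderson_angle c \<rho> \<delta>)"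
    using exists_norm_diff_le_sin[OF \<open>d0 - e \<noteq> 0\<close> anderson_angle_bounds[OF \<delta>]] by blast
  also have "\<dots> \<le> norm (p + s) * (SUP \<delta>\<in>{0..}. sin (anderson_angle c \<rho> \<delta>))"
    by (intro mult_left_mono Sup_sin_anderson_angle_upper \<delta>) simp
  finally show ?thesis
    unfolding d by (auto simp: mult.commute)
qed

end

section \<open>Residuals of Anderson acceleration\<close>

text \<open>Moving from the minimizer towards any \<open>r i\<close> stays in the affine hull, so
  the derivative of the squared norm in that direction vanishes.\<close>

lemma affine_min_norm_orthogonal:
  fixes r :: "'b \<Rightarrow> 'a::real_inner"
  assumes J: "finite J" "i \<in> J" and sum: "(\<Sum>j\<in>J. \<alpha> j) = 1"
    and min: "\<And>\<beta>. (\<Sum>j\<in>J. \<beta> j) = 1 \<Longrightarrow> norm (\<Sum>j\<in>J. \<alpha> j *\<^sub>R r j) \<le> norm (\<Sum>j\<in>J. \<beta> j *\<^sub>R r j)"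
  shows "(\<Sum>j\<in>J. \<alpha> j *\<^sub>R r j) \<bullet> (r i - (\<Sum>j\<in>J. \<alpha> j *\<^sub>R r j)) = 0"
proof -
  define p where "p = (\<Sum>j\<in>J. \<alpha> j *\<^sub>R r j)"
  have "p \<bullet> (r i - p) = 0"
  proof (rule quadratic_nonneg_imp_linear_zero[where b = "(r i - p) \<bullet> (r i - p)"])
    fix t :: real
    \<comment> \<open>Weights of the point a fraction \<open>t\<close> of the way from
      \<open>p\<close> to \<open>r i\<close>; their sum stays 1.\<close>
    define \<beta> where "\<beta> j = (1 - t) * \<alpha> j + (if j = i then t else 0)" for j
    have "(\<Sum>j\<in>J. \<beta> j) = 1"
      using J sum by (simp add: \<beta>_def sum.distrib sum_distrib_left[symmetric])
    moreover have "(\<Sum>j\<in>J. \<beta> j *\<^sub>R r j) = p + t *\<^sub>R (r i - p)"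
    proof -
      have "(\<Sum>j\<in>J. \<beta> j *\<^sub>R r j) = (\<Sum>j\<in>J. (1 - t) *\<^sub>R (\<alpha> j *\<^sub>R r j) + (if j = i then t *\<^sub>R r j else 0))"
        by (intro sum.cong) (auto simp: \<beta>_def scaleR_left_distrib)
      also have "\<dots> = (1 - t) *\<^sub>R p + t *\<^sub>R r i"
        unfolding sum.distrib scaleR_sum_right[symmetric] p_def using J by simp
      finally show ?thesis by (simp add: algebra_simps)
    qed
    ultimately have "norm p \<le> norm (p + t *\<^sub>R (r i - p))"
      using min[of \<beta>] by (simp add: p_def)
    then have "(norm p)\<^sup>2 \<le> (norm (p + t *\<^sub>R (r i - p)))\<^sup>2"
      by (intro power_mono) auto
    also have "\<dots> = (norm p)\<^sup>2 + (2 * t * (p \<bullet> (r i - p)) + t\<^sup>2 * ((r i - p) \<bullet> (r i - p)))"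
      unfolding power2_norm_eq_inner inner_add_left inner_add_right inner_scaleR_left
        inner_scaleR_right inner_commute[of "r i - p" p]
      by (simp add: power2_eq_square distrib_left)
    finally show "0 \<le> 2 * t * (p \<bullet> (r i - p)) + t\<^sup>2 * ((r i - p) \<bullet> (r i - p))"
      by simp
  qed
  then show ?thesis by (simp only: p_def)
qed

text \<open>At index 0 the window is a single point with weight 1, so the initial step has the
  general form and later estimates can start at 0.\<close>

lemma anderson_step:
  assumes "anderson_sequence m q x0 x"
  shows "\<exists>\<alpha>. anderson_weights m q x k \<alpha> \<and> x (Suc k) = (\<Sum>j\<in>{k - min m k..k}. \<alpha> j *\<^sub>R q (x j))"
proof (cases "k = 0")
  case True
  have "anderson_weights m q x 0 (\<lambda>_. 1)"
    by (simp add: anderson_weights_def)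
  moreover have "x 1 = q (x 0)"
    using assms by (simp add: anderson_sequence_def)
  ultimately show ?thesis
    using True by (intro exI[of _ "\<lambda>_. 1"]) simp
next
  case False
  then show ?thesis
    using assms by (simp add: anderson_sequence_def)
qed

text \<open>An affine map commutes with combinations whose weights sum to 1, so the new iterate is
  \<open>q z\<close> for a combination \<open>z\<close> of the old ones, and
  \<open>q (q z) - q z = W *v (q z - z)\<close>.\<close>

lemma affine_residual_step:
  fixes W :: "real ^ 'n ^ 'n" and y :: "'b \<Rightarrow> real ^ 'n"
  assumes q: "q = (\<lambda>x. W *v x + a)" and sum: "(\<Sum>j\<in>J. \<alpha> j) = 1"
  shows "q (\<Sum>j\<in>J. \<alpha> j *\<^sub>R q (y j)) - (\<Sum>j\<in>J. \<alpha> j *\<^sub>R q (y j))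
    = W *v (\<Sum>j\<in>J. \<alpha> j *\<^sub>R (q (y j) - y j))"
proof -
  have lin: "W *v (\<Sum>j\<in>J. \<alpha> j *\<^sub>R y j) = (\<Sum>j\<in>J. \<alpha> j *\<^sub>R (W *v y j))"
    by (simp add: linear_sum[OF matrix_vector_mul_linear] matrix_vector_mult_scaleR)
  have "(\<Sum>j\<in>J. \<alpha> j *\<^sub>R q (y j)) = q (\<Sum>j\<in>J. \<alpha> j *\<^sub>R y j)"
    by (simp add: q lin scaleR_right_distrib sum.distrib scaleR_sum_left[symmetric] sum)
  then show ?thesis
    by (simp add: q scaleR_right_diff_distrib sum_subtractf matrix_vector_mult_diff_distrib)
qed

section \<open>From a two-step contraction to the r-linear factor\<close>

text \<open>The two parities decay separately; the terms \<open>r 0\<close> and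
  \<open>r 1 / \<sigma>\<close> of the constant start one chain each. The restriction to
  \<open>2 \<le> k\<close> covers \<sigma> = 0, where the bound can fail at index 1.\<close>

lemma two_step_geometric_bound:
  fixes r :: "nat \<Rightarrow> real"
  assumes "\<And>k. r (k + 2) \<le> \<sigma>\<^sup>2 * r k" and nonneg: "\<And>k. 0 \<le> r k" and \<sigma>: "0 \<le> \<sigma>"
  shows "2 \<le> k \<Longrightarrow> r k \<le> (r 0 + r 1 / \<sigma>) * \<sigma> ^ k"
proof (induction k rule: less_induct)
  case (less k)
  define j where "j = k - 2"
  have k: "k = j + 2" using less.prems by (simp add: j_def)
  have step: "r k \<le> \<sigma>\<^sup>2 * r j" using assms(1) k by simp
  consider "j = 0" | "j = 1" | "2 \<le> j" by linarith
  then show ?case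
  proof cases
    case 1
    have "\<sigma>\<^sup>2 * r 0 \<le> \<sigma>\<^sup>2 * (r 0 + r 1 / \<sigma>)"
      using nonneg[of 1] \<sigma> by (intro mult_left_mono) auto
    with step show ?thesis by (simp only: k 1 add_0 mult.commute)
  next
    case 2
    then have k3: "k = 3" using k by simp
    have "\<sigma>\<^sup>2 * r 1 \<le> (r 0 + r 1 / \<sigma>) * \<sigma> ^ 3"
      using nonneg[of 0] \<sigma> by (cases "\<sigma> = 0") (simp_all add: power3_eq_cube power2_eq_square field_simps)
    with step show ?thesis by (simp add: k3 2)
  next
    case 3
    have "r j \<le> (r 0 + r 1 / \<sigma>) * \<sigma> ^ j"
      using less.IH[of j] 3 k by simp
    then have "\<sigma>\<^sup>2 * r j \<le> \<sigma>\<^sup>2 * ((r 0 + r 1 / \<sigma>) * \<sigma> ^ j)"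
      by (rule mult_left_mono) simp
    with step show ?thesis by (simp add: k power_add mult_ac power2_eq_square)
  qed
qed

text \<open>The k-th root of the constant \<open>C\<close> tends to 1, so only \<sigma> is left in
  the upper limit.\<close>

lemma r_factor_le_geometric:
  fixes x :: "nat \<Rightarrow> real ^ 'n"
  assumes C: "0 < C" and \<sigma>: "0 \<le> \<sigma>" and le: "\<And>k. 2 \<le> k \<Longrightarrow> norm (l - x k) \<le> C * \<sigma> ^ k"
  shows "r_factor x l \<le> ereal \<sigma>"
proof -
  have "\<forall>\<^sub>F k in sequentially. ereal (norm (l - x k) powr (1 / real k)) \<le> ereal (C powr (1 / real k) * \<sigma>)"
    using eventually_ge_at_top[of 2]
  proof eventually_elim
    case (elim k)
    have "norm (l - x k) powr (1 / real k) \<le> (C * \<sigma> ^ k) powr (1 / real k)"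
      using le[OF elim] by (intro powr_mono2) auto
    also have "\<dots> = C powr (1 / real k) * (\<sigma> ^ k) powr (1 / real k)"
      using C \<sigma> by (simp add: powr_mult)
    also have "(\<sigma> ^ k) powr (1 / real k) = \<sigma>"
    proof (cases "\<sigma> = 0")
      case False
      then have "(\<sigma> ^ k) powr (1 / real k) = \<sigma> powr (real k * (1 / real k))"
        using \<sigma> by (simp only: powr_realpow[symmetric] powr_powr)
      then show ?thesis
        using \<sigma> elim by simp
    qed (use elim in auto)
    finally show ?case by simp
  qed
  then have "r_factor x l \<le> limsup (\<lambda>k. ereal (C powr (1 / real k) * \<sigma>))"
    unfolding r_factor_def by (rule Limsup_mono)
  also have "(\<lambda>k. C powr (1 / real k) * \<sigma>) \<longlonglongrightarrow> C powr 0 * \<sigma>"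
    using C by (intro tendsto_intros lim_1_over_n) auto
  then have "limsup (\<lambda>k. ereal (C powr (1 / real k) * \<sigma>)) = ereal \<sigma>"
    using C by (intro lim_imp_Limsup) auto
  finally show ?thesis .
qed

section \<open>Invertibility of \<open>W - I\<close> and the fixed point\<close>

text \<open>Reverse triangle inequality. It turns residual bounds into error bounds and makes
  \<open>W - mat 1\<close> injective.\<close>

lemma norm_minus_mat_1_ge:
  fixes W :: "real ^ 'n ^ 'n"
  shows "(1 - spectral_norm W) * norm y \<le> norm ((W - mat 1) *v y)"
proof -
  have "norm y - norm (W *v y) \<le> norm ((W - mat 1) *v y)"
    using norm_triangle_ineq2[of y "W *v y"] by (simp add: matrix_vector_mult_diff_rdistrib norm_minus_commute)
  then show ?thesis
    using norm_matrix_vector_le_spectral_norm[of W y] by (simp add: algebra_simps)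
qed

text \<open>Injectivity of \<open>W - mat 1\<close> gives uniqueness and, in finite dimension,
  surjectivity and thus existence; so \<open>THE\<close> denotes a genuine fixed point.\<close>

lemma affine_contraction_fixed_point:
  fixes W :: "real ^ 'n ^ 'n"
  assumes norm: "spectral_norm W < 1" and q: "q = (\<lambda>x. W *v x + a)"
  shows "q (THE x. q x = x) = (THE x. q x = x)"
proof -
  have inj: "y = 0" if "(W - mat 1) *v y = 0" for y
    using norm_minus_mat_1_ge[of W y] that norm by (simp add: mult_le_0_iff)
  have "inj ((*v) (W - mat 1))"
    using inj by (subst linear_injective_0[OF matrix_vector_mul_linear]) auto
  then have "surj ((*v) (W - mat 1))"
    by (intro linear_inj_imp_surj matrix_vector_mul_linear)
  then obtain z where z: "(W - mat 1) *v z = - a"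
    by (metis surjD)
  have fix_iff: "q x = x \<longleftrightarrow> (W - mat 1) *v x = - a" for x
    by (auto simp: q matrix_vector_mult_diff_rdistrib algebra_simps eq_neg_iff_add_eq_0)
  show ?thesis
  proof (rule theI[of "\<lambda>x. q x = x" z])
    show "q z = z" using z fix_iff by simp
    fix y assume "q y = y"
    then have "(W - mat 1) *v (y - z) = 0"
      using z fix_iff by (simp add: matrix_vector_mult_diff_distrib)
    then have "y - z = 0" by (rule inj)
    then show "y = z" by simp
  qed
qed

section \<open>Two-step contraction of the residuals\<close>

context
  fixes W :: "real ^ 'n ^ 'n"
  assumes sym: "transpose W = W" and norm: "spectral_norm W < 1"
begin

abbreviation "mid \<equiv> (lambda_max W + lambda_min W) / 2"
abbreviation "rad \<equiv> (lambda_max W - lambda_min W) / 2"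

lemma spectral_interval_symmetric: "spectral_interval mid rad"
  using spectral_norm_symmetric[OF sym] lambda_min_le_lambda_max[OF sym] norm
  by unfold_locales auto

interpretation spectral_interval mid rad
  by (rule spectral_interval_symmetric)

lemma w0_symmetric: "w0 W = (SUP \<delta>\<in>{0..}. sin (anderson_angle mid rad \<delta>))"
proof -
  have "\<bar>lambda_max W - lambda_min W\<bar> * \<delta> / sqrt (4 + (2 - lambda_max W - lambda_min W)\<^sup>2 * \<delta>\<^sup>2)
      = rad * \<delta> / sqrt (1 + (1 - mid)\<^sup>2 * \<delta>\<^sup>2)" for \<delta>
  proof -
    have "2 - lambda_max W - lambda_min W = 2 * (1 - mid)"
      by (simp add: field_simps)
    then have "4 + (2 - lambda_max W - lambda_min W)\<^sup>2 * \<delta>\<^sup>2 = 4 * (1 + (1 - mid)\<^sup>2 * \<delta>\<^sup>2)"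
      by (simp only: power_mult_distrib) simp
    then have "sqrt (4 + (2 - lambda_max W - lambda_min W)\<^sup>2 * \<delta>\<^sup>2) = 2 * sqrt (1 + (1 - mid)\<^sup>2 * \<delta>\<^sup>2)"
      by (simp only: real_sqrt_mult real_sqrt_four)
    then show ?thesis
      using lambda_min_le_lambda_max[OF sym] by simp
  qed
  then show ?thesis
    unfolding w0_def anderson_angle_def by simp
qed

lemma w0_nonneg: "0 \<le> w0 W"
  unfolding w0_symmetric by (rule Sup_sin_anderson_angle_nonneg)

lemma w0_le_spectral_norm: "w0 W \<le> spectral_norm W"
  unfolding w0_symmetric spectral_norm_symmetric[OF sym] by (rule Sup_sin_anderson_angle_le)

lemma w0_eq_spectral_norm_iff: "w0 W = spectral_norm W \<longleftrightarrow> lambda_max W = - lambda_min W"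
  unfolding w0_symmetric spectral_norm_symmetric[OF sym] Sup_sin_anderson_angle_eq_iff by auto

text \<open>The second minimization is compared only with points on the line through the two newest
  residuals, so one bound serves every depth.\<close>

lemma anderson_residual_two_step:
  assumes m: "m \<ge> 1" and q: "q = (\<lambda>x. W *v x + a)" and seq: "anderson_sequence m q x0 x"
  shows "norm (q (x (k + 2)) - x (k + 2)) \<le> w0 W * spectral_norm W * norm (q (x k) - x k)"
proof -
  define r where "r j = q (x j) - x j" for j
  obtain \<alpha> where \<alpha>: "anderson_weights m q x k \<alpha>"
      "x (Suc k) = (\<Sum>j\<in>{k - min m k..k}. \<alpha> j *\<^sub>R q (x j))"
    using anderson_step[OF seq] by blast
  define p where "p = (\<Sum>j\<in>{k - min m k..k}. \<alpha> j *\<^sub>R r j)"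
  have "(\<Sum>j\<in>{k - min m k..k}. \<alpha> j) = 1"
    using \<alpha>(1) by (simp add: anderson_weights_def Let_def)
  from affine_residual_step[OF q this, of x] have r1: "r (Suc k) = W *v p"
    by (simp add: \<alpha>(2)[symmetric] r_def p_def)
  have orth: "p \<bullet> (r k - p) = 0"
    unfolding p_def using \<alpha>(1)
    by (intro affine_min_norm_orthogonal) (auto simp: anderson_weights_def Let_def r_def)
  have w: "norm (W *v p - mid *\<^sub>R p) \<le> rad * norm p"
    by (rule norm_symmetric_minus_midpoint_le[OF sym])
  obtain t where t: "norm (r k - t *\<^sub>R (r k - r (Suc k))) \<le> w0 W * norm (r k)"
    using exists_norm_affine_combination_le[OF orth w] by (auto simp: r1 w0_symmetric)
  define J where "J = {Suc k - min m (Suc k)..Suc k}"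
  \<comment> \<open>By \<open>m \<ge> 1\<close> the window at \<open>Suc k\<close> holds both newest
    indices.\<close>
  have J: "finite J" "{k, Suc k} \<subseteq> J"
    using m by (auto simp: J_def)
  obtain \<beta> where \<beta>: "anderson_weights m q x (Suc k) \<beta>"
      "x (Suc (Suc k)) = (\<Sum>j\<in>J. \<beta> j *\<^sub>R q (x j))"
    using anderson_step[OF seq] unfolding J_def by blast
  define p' where "p' = (\<Sum>j\<in>J. \<beta> j *\<^sub>R r j)"
  have "(\<Sum>j\<in>J. \<beta> j) = 1"
    using \<beta>(1) by (simp add: anderson_weights_def J_def Let_def)
  from affine_residual_step[OF q this, of x] have r2: "r (Suc (Suc k)) = W *v p'"
    by (simp add: \<beta>(2)[symmetric] r_def p'_def)
  \<comment> \<open>Competing weights that realize the point of the line found above.\<close>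
  define \<gamma> where "\<gamma> j = (if j = k then 1 - t else if j = Suc k then t else 0)" for j
  have "(\<Sum>j\<in>J. \<gamma> j) = (\<Sum>j\<in>{k, Suc k}. \<gamma> j)"
    using J by (intro sum.mono_neutral_right) (auto simp: \<gamma>_def)
  then have "(\<Sum>j\<in>J. \<gamma> j) = 1"
    by (simp add: \<gamma>_def)
  then have "norm p' \<le> norm (\<Sum>j\<in>J. \<gamma> j *\<^sub>R r j)"
    using \<beta>(1) by (simp add: anderson_weights_def Let_def J_def[symmetric] r_def p'_def)
  also have "(\<Sum>j\<in>J. \<gamma> j *\<^sub>R r j) = (\<Sum>j\<in>{k, Suc k}. \<gamma> j *\<^sub>R r j)"
    using J by (intro sum.mono_neutral_right) (auto simp: \<gamma>_def)
  also have "\<dots> = r k - t *\<^sub>R (r k - r (Suc k))"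
    by (simp add: \<gamma>_def algebra_simps)
  finally have p': "norm p' \<le> w0 W * norm (r k)"
    using t by linarith
  have "norm (r (Suc (Suc k))) \<le> spectral_norm W * norm p'"
    unfolding r2 by (rule norm_matrix_vector_le_spectral_norm)
  also have "\<dots> \<le> spectral_norm W * (w0 W * norm (r k))"
    using p' w0_nonneg w0_le_spectral_norm by (intro mult_left_mono) auto
  finally show ?thesis
    by (simp add: r_def mult_ac)
qed

end

theorem theorem1:
  fixes W :: "real ^ 'n ^ 'n" and a xs :: "real ^ 'n" and m :: nat
    and q :: "real ^ 'n \<Rightarrow> real ^ 'n"
  assumes m: "m \<ge> 1"
    and sym: "transpose W = W"
    and norm: "spectral_norm W < 1"
    and q: "q = (\<lambda>x. W *v x + a)"
    and xs: "xs = (THE x. q x = x)"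
  shows "(\<forall>x0 x. anderson_sequence m q x0 x \<longrightarrow>
            converges_r_linearly x xs \<and>
            r_factor x xs \<le> ereal (sqrt (w0 W * spectral_norm W)) \<and>
            (\<forall>k\<ge>2. x (k - 1) \<noteq> xs \<longrightarrow>
               norm ((W - mat 1) *v (x (k + 1) - xs)) / norm ((W - mat 1) *v (x (k - 1) - xs))
                 \<le> w0 W * spectral_norm W)) \<and>
         w0 W \<le> spectral_norm W \<and>
         (w0 W = spectral_norm W \<longleftrightarrow> lambda_max W = - lambda_min W)"
proof (intro conjI allI impI)
  show "w0 W \<le> spectral_norm W"
    by (rule w0_le_spectral_norm[OF sym norm])
  show "w0 W = spectral_norm W \<longleftrightarrow> lambda_max W = - lambda_min W"
    by (rule w0_eq_spectral_norm_iff[OF sym norm])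
  fix x0 x assume seq: "anderson_sequence m q x0 x"
  have fixed: "q xs = xs"
    unfolding xs by (rule affine_contraction_fixed_point[OF norm q])
  have residual: "q y - y = (W - mat 1) *v (y - xs)" for y
  proof -
    have "q y - y = (q y - q xs) - (y - xs)"
      by (simp add: fixed)
    then show ?thesis
      by (simp add: q matrix_vector_mult_diff_rdistrib matrix_vector_mult_diff_distrib)
  qed
  define r where "r k = norm ((W - mat 1) *v (x k - xs))" for k
  let ?\<kappa> = "spectral_norm W"
  \<comment> \<open>The square root appears because the contraction is per two steps.\<close>
  define \<sigma> where "\<sigma> = sqrt (w0 W * ?\<kappa>)"
  note w0 = w0_nonneg[OF sym norm] w0_le_spectral_norm[OF sym norm]
  have \<sigma>: "0 \<le> \<sigma>" "\<sigma>\<^sup>2 = w0 W * ?\<kappa>"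
    using w0 by (auto simp: \<sigma>_def)
  have "w0 W * ?\<kappa> \<le> 1 * ?\<kappa>"
    using w0 norm by (intro mult_right_mono) auto
  then have \<sigma>1: "\<sigma> < 1"
    using norm by (simp add: \<sigma>_def)
  have step: "r (k + 2) \<le> \<sigma>\<^sup>2 * r k" for k
    using anderson_residual_two_step[OF sym norm m q seq, of k] by (simp add: \<sigma> r_def residual)
  \<comment> \<open>Division by \<open>1 - ?\<kappa>\<close> passes from residuals to errors; the
    summand 1 makes \<open>C\<close> positive even if the residuals vanish.\<close>
  define C where "C = (r 0 + r 1 / \<sigma>) / (1 - ?\<kappa>) + 1"
  have "0 \<le> (r 0 + r 1 / \<sigma>) / (1 - ?\<kappa>)"
    unfolding r_def using \<sigma>(1) norm
    by (intro divide_nonneg_nonneg add_nonneg_nonneg norm_ge_zero) auto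
  then have C: "0 < C"
    unfolding C_def by linarith
  have le: "norm (xs - x k) \<le> C * \<sigma> ^ k" if "2 \<le> k" for k
  proof -
    have "norm (xs - x k) * (1 - ?\<kappa>) \<le> r k"
      using norm_minus_mat_1_ge[of W "x k - xs"]
      by (simp only: r_def norm_minus_commute[of xs] mult.commute[of "1 - ?\<kappa>"])
    also have "r k \<le> (r 0 + r 1 / \<sigma>) * \<sigma> ^ k"
      by (rule two_step_geometric_bound[of r, OF step _ \<sigma>(1) that]) (simp add: r_def)
    finally have "norm (xs - x k) \<le> (r 0 + r 1 / \<sigma>) * \<sigma> ^ k / (1 - ?\<kappa>)"
      using norm by (subst pos_le_divide_eq) simp_all
    also have "\<dots> = (r 0 + r 1 / \<sigma>) / (1 - ?\<kappa>) * \<sigma> ^ k"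
      by (rule times_divide_eq_left[symmetric])
    also have "\<dots> \<le> C * \<sigma> ^ k"
      unfolding C_def using \<sigma>(1) by (intro mult_right_mono zero_le_power) linarith+
    finally show ?thesis .
  qed
  show factor: "r_factor x xs \<le> ereal (sqrt (w0 W * ?\<kappa>))"
    unfolding \<sigma>_def[symmetric] by (rule r_factor_le_geometric[OF C \<sigma>(1) le])
  have "(\<lambda>k. C * \<sigma> ^ k) \<longlonglongrightarrow> C * 0"
    using \<sigma>(1) \<sigma>1 by (intro tendsto_mult tendsto_const LIMSEQ_power_zero) simp
  then have "(\<lambda>k. C * \<sigma> ^ k) \<longlonglongrightarrow> 0"
    by simp
  moreover have "\<forall>\<^sub>F k in sequentially. norm (xs - x k) \<le> C * \<sigma> ^ k"
    using eventually_ge_at_top[of 2] by eventually_elim (rule le)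
  ultimately have "(\<lambda>k. xs - x k) \<longlonglongrightarrow> 0"
    by (rule Lim_null_comparison[rotated])
  from tendsto_diff[OF tendsto_const[of xs] this] have "x \<longlonglongrightarrow> xs"
    by simp
  moreover have "r_factor x xs < 1"
    using factor[folded \<sigma>_def] by (rule le_less_trans) (simp add: \<sigma>1)
  ultimately show "converges_r_linearly x xs"
    by (simp add: converges_r_linearly_def)
  fix k :: nat assume k: "2 \<le> k" "x (k - 1) \<noteq> xs"
  \<comment> \<open>A nonzero error forces a nonzero residual, so the quotient has a positive
    denominator.\<close>
  have "0 < (1 - ?\<kappa>) * norm (x (k - 1) - xs)"
    using norm k by simp
  also have "\<dots> \<le> r (k - 1)"
    unfolding r_def by (rule norm_minus_mat_1_ge)
  finally have "0 < r (k - 1)" .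
  moreover have "r (k + 1) \<le> \<sigma>\<^sup>2 * r (k - 1)"
    using step[of "k - 1"] k by simp
  ultimately show "norm ((W - mat 1) *v (x (k + 1) - xs)) / norm ((W - mat 1) *v (x (k - 1) - xs))
      \<le> w0 W * ?\<kappa>"
    by (simp add: r_def \<sigma> pos_divide_le_eq)
qed

end
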